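(* Let $(M,d)$ be a proper metric space. Let $(X_n)_{n\in\mathbf{N}}$ be a sequence of i.i.d. $M$-valued random variables of law $\mu\in P_1(M)$, and let $(m_n)_{n\in\mathbf{N}}$ be a sequence of random variables such that $m_n\in Q_{\mu_n}$, where $\mu_n=\frac1n\sum_{k=1}^n\delta_{X_k}$. If $\mu$ has a unique Fréchet median $m$, then $m_n\to m$ almost surely.
   Context: A metric space is proper if every bounded closed subset is compact. $P_1(M)$ is the set of probability measures $\mu$ on $M$ with $\int_M d(x_0,p)\,\mu(dp)<\infty$ for some $x_0\in M$. For $\mu\in P_1(M)$, $f_\mu(x)=\int_M d(x,p)\,\mu(dp)$, $x\in M$; it attains its minimum, and $Q_\mu$ is the set of its global minimum points (the Fréchet medians of $\mu$). *)

theory Defs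
  imports "HOL-Probability.Probability"
begin

definition P1 :: "'a::metric_space measure set" where
  "P1 = {\<mu>. prob_space \<mu> \<and> sets \<mu> = sets borel \<and> (\<exists>x0. integrable \<mu> (\<lambda>p. dist x0 p))}"

definition mean_dist :: "'a::metric_space measure \<Rightarrow> 'a \<Rightarrow> real" where
  "mean_dist \<mu> x = (\<integral>p. dist x p \<partial>\<mu>)"

definition frechet_medians :: "'a::metric_space measure \<Rightarrow> 'a set" where
  "frechet_medians \<mu> = {x. \<forall>y. mean_dist \<mu> x \<le> mean_dist \<mu> y}"

text \<open>Sequences are indexed from 1; \<open>empirical_measure x 0\<close> is the zero measure.\<close>

definition empirical_measure :: "(nat \<Rightarrow> 'a::metric_space) \<Rightarrow> nat \<Rightarrow> 'a measure" where
  "empirical_measure x n = measure_of UNIV (sets borel)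
     (\<lambda>A. ennreal (1 / real n) * (\<Sum>k=1..n. emeasure (return borel (x k)) A))"

text \<open>The set function in \<open>empirical_measure_def\<close> is countably additive, so \<open>measure_of\<close> does not
  fall back to the zero measure.\<close>

lemma sets_empirical_measure [simp]: "sets (empirical_measure x n) = sets borel"
  by (simp add: empirical_measure_def sets.sigma_sets_eq[of borel, simplified])

lemma space_empirical_measure [simp]: "space (empirical_measure x n) = UNIV"
  by (simp add: empirical_measure_def)

lemma emeasure_empirical_measure:
  assumes "A \<in> sets borel"
  shows "emeasure (empirical_measure x n) A =
    ennreal (1 / real n) * (\<Sum>k=1..n. emeasure (return borel (x k)) A)"
proof (rule emeasure_measure_of[OF empirical_measure_def])
  let ?f = "\<lambda>A. ennreal (1 / real n) * (\<Sum>k=1..n. emeasure (return borel (x k)) A)"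
  show "positive (sets (empirical_measure x n)) ?f"
    by (simp add: positive_def)
  show "countably_additive (sets (empirical_measure x n)) ?f"
  proof (rule countably_additiveI)
    fix B :: "nat \<Rightarrow> 'a set"
    assume B: "range B \<subseteq> sets (empirical_measure x n)" "disjoint_family B"
    have "(\<Sum>i. ?f (B i)) = ennreal (1 / real n) * (\<Sum>i. \<Sum>k=1..n. emeasure (return borel (x k)) (B i))"
      by (rule ennreal_suminf_cmult)
    also have "(\<Sum>i. \<Sum>k=1..n. emeasure (return borel (x k)) (B i)) =
        (\<Sum>k=1..n. \<Sum>i. emeasure (return borel (x k)) (B i))"
      by (rule suminf_sum) simp
    also have "\<dots> = (\<Sum>k=1..n. emeasure (return borel (x k)) (\<Union>i. B i))"
      using B by (intro sum.cong refl suminf_emeasure) auto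
    finally show "(\<Sum>i. ?f (B i)) = ?f (\<Union>i. B i)" .
  qed
qed (use assms in auto)

end

theory Submission
  imports Defs
begin

text \<open>
  A median of the empirical measure \<open>\<mu>\<^sub>n\<close> minimises \<open>x \<mapsto> 1/n * (\<Sum>k=1..n. h\<^sub>x (X\<^sub>k))\<close>, where
  \<open>h\<^sub>x p = d(x, p) - d(m\<^sub>0, p)\<close> is the distance function renormalised at \<open>m\<^sub>0\<close>: the subtracted term
  does not depend on \<open>x\<close>. The gain is that \<open>h\<^sub>x\<close> is bounded by \<open>d(x, m\<^sub>0)\<close>, so that only
  averages of bounded variables have to be controlled, and for these the strong law of large
  numbers is a consequence of Hoeffding's inequality and the Borel--Cantelli lemma
  (\<open>bounded_strong_law\<close>).

  Two things then have to be excluded. The empirical medians cannot escape to infinity: choose a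
  ball around \<open>m\<^sub>0\<close> of radius \<open>r\<close> and \<open>\<mu>\<close>-mass more than \<open>3/4\<close>; by the strong law it eventually
  contains three quarters of the sample, and then every empirical median has distance at most
  \<open>3 r\<close> from \<open>m\<^sub>0\<close> (\<open>empirical_median_bounded\<close>). Nor can they stay in the closed annulus
  \<open>\<epsilon> \<le> d(x, m\<^sub>0) \<le> 3 r\<close>. This annulus is compact, and the mean of \<open>h\<^sub>x\<close> is positive at each of
  its points because \<open>m\<^sub>0\<close> is the only median of \<open>\<mu>\<close>. As \<open>x \<mapsto> h\<^sub>x\<close> is nonexpansive, positivity of
  the empirical averages at finitely many centres, which the strong law provides, propagates to
  the whole annulus (\<open>eventually_averages_pos_on_compact\<close>), whereas at an empirical median the
  average is at most \<open>0\<close>.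
\<close>

section \<open>Strong law of large numbers for bounded variables\<close>

text \<open>Almost sure convergence only involves countably many tolerances, so the null set may be
  chosen after the tolerance.\<close>

lemma AE_tendstoI:
  fixes f :: "nat \<Rightarrow> 'w \<Rightarrow> 'a::metric_space"
  assumes "\<And>e::real. e > 0 \<Longrightarrow> AE \<omega> in M. eventually (\<lambda>n. dist (f n \<omega>) l < e) sequentially"
  shows "AE \<omega> in M. (\<lambda>n. f n \<omega>) \<longlonglongrightarrow> l"
proof -
  have "AE \<omega> in M. \<forall>j. eventually (\<lambda>n. dist (f n \<omega>) l < inverse (real (Suc j))) sequentially"
    unfolding AE_all_countable by (intro allI assms) simp
  then show ?thesis
  proof eventually_elim
    case (elim \<omega>)
    show ?case
    proof (rule tendstoI)
      fix e :: real assume "e > 0"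
      then obtain j where j: "inverse (real (Suc j)) < e"
        using reals_Archimedean by blast
      from elim have "eventually (\<lambda>n. dist (f n \<omega>) l < inverse (real (Suc j))) sequentially"
        by blast
      then show "eventually (\<lambda>n. dist (f n \<omega>) l < e) sequentially"
        by eventually_elim (use j in linarith)
    qed
  qed
qed

text \<open>Hoeffding's inequality makes the probability that the \<open>n\<close>-th average deviates by
  \<open>\<epsilon>\<close> decay geometrically in \<open>n\<close>; the probabilities are therefore summable along the full sequence,
  and Borel--Cantelli applies.\<close>

lemma (in prob_space) bounded_strong_law:
  fixes Y :: "nat \<Rightarrow> 'a \<Rightarrow> real"
  assumes indep: "indep_vars (\<lambda>_. borel) Y {1..}"
    and bound: "\<And>k. k \<ge> 1 \<Longrightarrow> AE \<omega> in M. \<bar>Y k \<omega>\<bar> \<le> B"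
    and expect: "\<And>k. k \<ge> 1 \<Longrightarrow> expectation (Y k) = e"
  shows "AE \<omega> in M. (\<lambda>n. (\<Sum>k=1..n. Y k \<omega>) / real n) \<longlonglongrightarrow> e"
proof (rule AE_tendstoI)
  fix \<epsilon> :: real assume \<epsilon>: "\<epsilon> > 0"
  have Y[measurable]: "Y k \<in> borel_measurable M" if "k \<ge> 1" for k
    using indep that by (auto simp: indep_vars_def2)
  \<comment> \<open>The enlarged bound keeps the interval \<open>{-C..C}\<close> nondegenerate.\<close>
  define C where "C = \<bar>B\<bar> + 1"
  have C: "C > 0" by (simp add: C_def)
  define q where "q = exp (- (\<epsilon>\<^sup>2 / (2 * C\<^sup>2)))"
  have q: "0 < q" "q < 1" using \<epsilon> C by (auto simp: q_def)
  define A where "A n = {\<omega> \<in> space M. \<bar>(\<Sum>k=1..n. Y k \<omega>) - real n * e\<bar> \<ge> real n * \<epsilon>}" for n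
  have A_sets: "A n \<in> sets M" for n
  proof -
    have [measurable]: "(\<lambda>\<omega>. \<Sum>k=1..n. Y k \<omega>) \<in> borel_measurable M"
      by (intro borel_measurable_sum Y) auto
    show ?thesis unfolding A_def by measurable
  qed
  have A_prob: "prob (A n) \<le> 2 * q ^ n" if n: "n \<ge> 1" for n
  proof -
    interpret H: Hoeffding_ineq M "{1..n}" Y "\<lambda>_. -C" "\<lambda>_. C" "real n * e"
    proof unfold_locales
      show "indep_vars (\<lambda>_. borel) Y {1..n}"
        by (rule indep_vars_subset[OF indep]) auto
      show "AE \<omega> in M. Y i \<omega> \<in> {-C..C}" if "i \<in> {1..n}" for i
        using bound[of i] that by (auto simp: C_def elim!: eventually_mono)
      show "real n * e \<equiv> \<Sum>i\<in>{1..n}. expectation (Y i)"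
        by (rule eq_reflection) (simp add: expect)
    qed simp
    have "prob (A n) \<le> 2 * exp (- 2 * (real n * \<epsilon>)\<^sup>2 / (\<Sum>i\<in>{1..n}. (C - - C)\<^sup>2))"
      unfolding A_def by (rule H.Hoeffding_ineq_abs_ge) (use \<epsilon> C n in auto)
    also have "- 2 * (real n * \<epsilon>)\<^sup>2 / (\<Sum>i\<in>{1..n}. (C - - C)\<^sup>2) = real n * (- (\<epsilon>\<^sup>2 / (2 * C\<^sup>2)))"
      using n C by (simp add: field_simps power2_eq_square)
    also have "exp \<dots> = q ^ n" by (simp only: exp_of_nat_mult q_def)
    finally show ?thesis .
  qed
  have "AE \<omega> in M. eventually (\<lambda>n. \<omega> \<in> space M - A n) sequentially"
  proof (rule borel_cantelli_AE1)
    show "summable (\<lambda>n. prob (A n))"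
    proof (rule summable_comparison_test')
      show "summable (\<lambda>n. 2 * q ^ n)"
        using q by (intro summable_mult summable_geometric) auto
      show "norm (prob (A n)) \<le> 2 * q ^ n" if "n \<ge> 1" for n
        using A_prob[OF that] by simp
    qed
  qed (auto simp: A_sets less_top[symmetric])
  then show "AE \<omega> in M. eventually (\<lambda>n. dist ((\<Sum>k=1..n. Y k \<omega>) / real n) e < \<epsilon>) sequentially"
  proof eventually_elim
    case (elim \<omega>)
    then show ?case using eventually_ge_at_top[of 1]
    proof eventually_elim
      case (elim n)
      then have n: "real n > 0" and "\<bar>(\<Sum>k=1..n. Y k \<omega>) - real n * e\<bar> < real n * \<epsilon>"
        by (auto simp: A_def)
      moreover have "(\<Sum>k=1..n. Y k \<omega>) / real n - e = ((\<Sum>k=1..n. Y k \<omega>) - real n * e) / real n"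
        using n by (simp add: field_simps)
      ultimately show ?case
        by (simp add: dist_real_def abs_divide pos_divide_less_eq mult.commute)
    qed
  qed
qed

lemma (in prob_space) bounded_strong_law_iid:
  fixes h :: "'b \<Rightarrow> real"
  assumes indep: "indep_vars (\<lambda>_. N) X {1..}"
    and law: "\<And>k. k \<ge> 1 \<Longrightarrow> distr M N (X k) = \<mu>"
    and h[measurable]: "h \<in> borel_measurable N"
    and bound: "\<And>p. \<bar>h p\<bar> \<le> B"
  shows "AE \<omega> in M. (\<lambda>n. (\<Sum>k=1..n. h (X k \<omega>)) / real n) \<longlonglongrightarrow> (\<integral>p. h p \<partial>\<mu>)"
proof (rule bounded_strong_law)
  show "indep_vars (\<lambda>_. borel) (\<lambda>k \<omega>. h (X k \<omega>)) {1..}"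
    by (rule indep_vars_compose2[OF indep]) (rule h)
  fix k :: nat assume k: "k \<ge> 1"
  then have [measurable]: "X k \<in> M \<rightarrow>\<^sub>M N"
    using indep by (auto simp: indep_vars_def2)
  show "expectation (\<lambda>\<omega>. h (X k \<omega>)) = (\<integral>p. h p \<partial>\<mu>)"
    unfolding law[OF k, symmetric] by (subst integral_distr) auto
qed (use bound in auto)

section \<open>Medians of empirical measures\<close>

text \<open>The integral is reduced to a finite sum by recognising the empirical measure as the image
  of the uniform distribution on the index set.\<close>

lemma mean_dist_empirical_measure:
  assumes n: "n \<ge> 1"
  shows "mean_dist (empirical_measure x n) y = (\<Sum>k=1..n. dist y (x k)) / real n"
proof -
  have ne: "{1..n} \<noteq> {}" using n by auto
  have "empirical_measure x n = distr (measure_pmf (pmf_of_set {1..n})) borel x"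
  proof (rule measure_eqI)
    fix A assume "A \<in> sets (empirical_measure x n)"
    then have A: "A \<in> sets borel" by simp
    have "(\<Sum>k=1..n. emeasure (return borel (x k)) A) = (\<Sum>k=1..n. ennreal (indicator A (x k)))"
      using A by (simp add: ennreal_indicator)
    also have "\<dots> = ennreal (\<Sum>k=1..n. indicator A (x k))"
      by (rule sum_ennreal) simp
    also have "(\<Sum>k=1..n. indicator A (x k) :: real) = real (card ({1..n} \<inter> x -` A))"
      by (simp add: indicator_def sum.If_cases Int_def vimage_def)
    finally have "emeasure (empirical_measure x n) A
        = ennreal (1 / real n) * ennreal (real (card ({1..n} \<inter> x -` A)))"
      using A by (simp add: emeasure_empirical_measure)
    also have "\<dots> = emeasure (distr (measure_pmf (pmf_of_set {1..n})) borel x) A"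
      using A ne by (simp add: emeasure_distr emeasure_pmf_of_set ennreal_mult[symmetric])
    finally show "emeasure (empirical_measure x n) A
        = emeasure (distr (measure_pmf (pmf_of_set {1..n})) borel x) A" .
  qed simp
  then show ?thesis
    using ne by (simp add: mean_dist_def integral_distr integral_pmf_of_set
        borel_measurable_continuous_onI continuous_intros)
qed

text \<open>Comparing the median with an arbitrary reference point \<open>c\<close> turns minimality into an
  inequality for an average of bounded functions of the sample.\<close>

lemma empirical_median_average_nonpos:
  assumes n: "n \<ge> 1" and y: "y \<in> frechet_medians (empirical_measure x n)"
  shows "(\<Sum>k=1..n. dist y (x k) - dist c (x k)) / real n \<le> 0"
proof -
  have "mean_dist (empirical_measure x n) y \<le> mean_dist (empirical_measure x n) c"
    using y by (simp add: frechet_medians_def)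
  then show ?thesis
    using n by (simp add: mean_dist_empirical_measure sum_subtractf diff_divide_distrib)
qed

text \<open>Moving from \<open>c\<close> to a point \<open>y\<close> at distance \<open>D\<close> increases the distance to each sample point in
  the ball by at least \<open>D - 2 r\<close> and decreases the others by at most \<open>D\<close>. If three quarters of the
  sample lie in the ball and \<open>D > 3 r\<close>, the losses do not compensate the gains.\<close>

lemma empirical_median_bounded:
  assumes n: "n \<ge> 1" and y: "y \<in> frechet_medians (empirical_measure x n)"
    and frac: "(\<Sum>k=1..n. indicator (cball c r) (x k)) / real n \<ge> (3/4::real)"
  shows "dist y c \<le> 3 * r"
proof (rule ccontr)
  assume "\<not> ?thesis"
  then have far: "dist y c > 3 * r" by simp
  define D where "D = dist y c"
  define S where "S = (\<Sum>k=1..n. indicator (cball c r) (x k) :: real)"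
  have S: "S \<ge> 3/4 * real n" using frac n by (simp add: S_def field_simps)
  have "S \<noteq> 0" using S n by auto
  then obtain k where "x k \<in> cball c r"
    unfolding S_def by (metis sum.neutral indicator_simps(2))
  then have r: "r \<ge> 0" by (simp add: order_trans[OF zero_le_dist])
  have "2 * (D - r) * indicator (cball c r) (x k) - D \<le> dist y (x k) - dist c (x k)" for k
    using dist_triangle[of y c "x k"] dist_triangle[of c "x k" y]
    by (auto simp: D_def indicator_def dist_commute)
  then have "(\<Sum>k=1..n. 2 * (D - r) * indicator (cball c r) (x k) - D)
      \<le> (\<Sum>k=1..n. dist y (x k) - dist c (x k))"
    by (intro sum_mono)
  also have "\<dots> \<le> 0"
    using empirical_median_average_nonpos[OF n y, of c] n by (simp add: divide_le_0_iff)
  finally have "2 * (D - r) * S - real n * D \<le> 0"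
    by (simp add: S_def sum_subtractf sum_distrib_left)
  moreover have "2 * (D - r) * (3/4 * real n) \<le> 2 * (D - r) * S"
    using S far r by (intro mult_left_mono) (auto simp: D_def)
  ultimately have "2 * (D - r) * (3/4 * real n) \<le> real n * D" by linarith
  then have "real n * (D - 3 * r) \<le> 0" by (simp add: algebra_simps)
  then show False using n far by (simp add: D_def mult_le_0_iff)
qed

section \<open>Averages over compact sets of centres\<close>

lemma abs_dist_diff_le: "\<bar>dist x p - dist c p\<bar> \<le> dist x (c::'a::metric_space)"
  using dist_triangle[of x p c] dist_triangle[of c p x] by (auto simp: dist_commute)

text \<open>A ball around \<open>x\<close> whose radius is half the limit at \<open>x\<close> is small enough for
  positivity at \<open>x\<close> to survive, since the averages are nonexpansive in \<open>x\<close>; by compactness finitely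
  many such balls suffice.\<close>

lemma eventually_averages_pos_on_compact:
  fixes X :: "nat \<Rightarrow> 'w \<Rightarrow> 'a::metric_space"
  assumes K: "compact K"
    and pos: "\<And>x. x \<in> K \<Longrightarrow> F x > 0"
    and lim: "\<And>x. x \<in> K \<Longrightarrow>
      AE \<omega> in M. (\<lambda>n. (\<Sum>k=1..n. dist x (X k \<omega>) - dist c (X k \<omega>)) / real n) \<longlonglongrightarrow> F x"
  shows "AE \<omega> in M. eventually (\<lambda>n. \<forall>y\<in>K.
      (\<Sum>k=1..n. dist y (X k \<omega>) - dist c (X k \<omega>)) / real n > 0) sequentially"
proof -
  have "K \<subseteq> (\<Union>x\<in>K. ball x (F x / 2))" using pos by force
  then obtain S where S: "S \<subseteq> K" "finite S" "K \<subseteq> (\<Union>x\<in>S. ball x (F x / 2))"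
    using compactE_image[OF K, of K "\<lambda>x. ball x (F x / 2)"] by auto
  have "AE \<omega> in M. \<forall>x\<in>S. (\<lambda>n. (\<Sum>k=1..n. dist x (X k \<omega>) - dist c (X k \<omega>)) / real n) \<longlonglongrightarrow> F x"
    using S by (intro AE_finite_allI lim) auto
  then show ?thesis
  proof eventually_elim
    case (elim \<omega>)
    have "eventually (\<lambda>n. \<forall>x\<in>S.
        (\<Sum>k=1..n. dist x (X k \<omega>) - dist c (X k \<omega>)) / real n > F x / 2) sequentially"
    proof (rule eventually_ball_finite[OF S(2)], rule ballI)
      fix x assume x: "x \<in> S"
      then have "F x / 2 < F x" using pos S by auto
      then show "eventually (\<lambda>n.
          (\<Sum>k=1..n. dist x (X k \<omega>) - dist c (X k \<omega>)) / real n > F x / 2) sequentially"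
        using elim x by (intro order_tendstoD(1)) auto
    qed
    then show ?case using eventually_ge_at_top[of 1]
    proof eventually_elim
      case (elim n)
      show ?case
      proof
        fix y assume "y \<in> K"
        then obtain x where x: "x \<in> S" "dist x y < F x / 2" using S by auto
        have "(\<Sum>k=1..n. (dist x (X k \<omega>) - dist c (X k \<omega>)) - dist x y)
            \<le> (\<Sum>k=1..n. dist y (X k \<omega>) - dist c (X k \<omega>))"
          by (intro sum_mono) (use dist_triangle[of x _ y] in \<open>simp add: algebra_simps\<close>)
        moreover have "(\<Sum>k=1..n. dist x (X k \<omega>) - dist c (X k \<omega>)) > real n * (F x / 2)"
          using elim x by (auto simp: field_simps)
        moreover have "real n * dist x y \<le> real n * (F x / 2)"
          using x by (intro mult_left_mono) auto
        ultimately have "(\<Sum>k=1..n. dist y (X k \<omega>) - dist c (X k \<omega>)) > 0"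
          by (simp add: sum_subtractf)
        then show "(\<Sum>k=1..n. dist y (X k \<omega>) - dist c (X k \<omega>)) / real n > 0"
          using elim by simp
      qed
    qed
  qed
qed

section \<open>Properties of the law\<close>

lemma P1_integrable_dist:
  assumes "\<mu> \<in> P1"
  shows "integrable \<mu> (\<lambda>p. dist x p)"
proof -
  from assms obtain x0 where P: "prob_space \<mu>" and sets_\<mu>[measurable_cong]: "sets \<mu> = sets borel"
      and x0: "integrable \<mu> (\<lambda>p. dist x0 p)"
    by (auto simp: P1_def)
  interpret prob_space \<mu> by (rule P)
  have "integrable \<mu> (\<lambda>p. dist x x0 + dist x0 p)" using x0 by simp
  then show ?thesis
  proof (rule Bochner_Integration.integrable_bound)
    show "(\<lambda>p. dist x p) \<in> borel_measurable \<mu>"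
      unfolding measurable_cong_sets[OF sets_\<mu> refl]
      by (intro borel_measurable_continuous_onI continuous_intros)
  qed (use dist_triangle[of x _ x0] in auto)
qed

lemma unique_median_excess_pos:
  assumes mu: "\<mu> \<in> P1" and unique: "frechet_medians \<mu> = {c}" and x: "x \<noteq> c"
  shows "(\<integral>p. dist x p - dist c p \<partial>\<mu>) > 0"
proof -
  have c: "mean_dist \<mu> c \<le> mean_dist \<mu> y" for y
    using unique by (auto simp: frechet_medians_def)
  have "x \<notin> frechet_medians \<mu>" using unique x by simp
  then obtain y where "mean_dist \<mu> y < mean_dist \<mu> x"
    by (auto simp: frechet_medians_def not_le)
  with c[of y] have "mean_dist \<mu> c < mean_dist \<mu> x" by simp
  then show ?thesis
    using mu by (simp add: mean_dist_def P1_integrable_dist)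
qed

lemma exists_cball_measure_gt:
  fixes \<mu> :: "'a::metric_space measure"
  assumes P: "prob_space \<mu>" and sets_\<mu>: "sets \<mu> = sets borel" and t: "t < 1"
  shows "\<exists>r. measure \<mu> (cball c r) > t"
proof -
  interpret prob_space \<mu> by (rule P)
  have "(\<lambda>n. measure \<mu> (cball c (real n))) \<longlonglongrightarrow> measure \<mu> (\<Union>n. cball c (real n))"
    by (rule finite_Lim_measure_incseq) (auto simp: sets_\<mu> incseq_def)
  also have "(\<Union>n. cball c (real n)) = space \<mu>"
    using sets_eq_imp_space_eq[OF sets_\<mu>] real_arch_simple by auto
  finally have "(\<lambda>n. measure \<mu> (cball c (real n))) \<longlonglongrightarrow> 1"
    by (simp add: prob_space)
  then have "eventually (\<lambda>n. t < measure \<mu> (cball c (real n))) sequentially"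
    using t by (rule order_tendstoD(1))
  then show ?thesis
    using eventually_happens by force
qed

section \<open>Consistency of empirical medians\<close>

theorem corollary1:
  fixes \<Omega> :: "'w measure"
    and X :: "nat \<Rightarrow> 'w \<Rightarrow> 'a::metric_space"
    and m :: "nat \<Rightarrow> 'w \<Rightarrow> 'a"
    and \<mu> :: "'a measure"
    and m0 :: 'a
  assumes proper: "\<And>S :: 'a set. bounded S \<Longrightarrow> closed S \<Longrightarrow> compact S"
    and prob: "prob_space \<Omega>"
    and mu: "\<mu> \<in> P1"
    and X_indep: "prob_space.indep_vars \<Omega> (\<lambda>_. borel) X {1..}"
    and X_law: "\<And>n. n \<ge> 1 \<Longrightarrow> distr \<Omega> borel (X n) = \<mu>"
    and m_rv: "\<And>n. n \<ge> 1 \<Longrightarrow> m n \<in> \<Omega> \<rightarrow>\<^sub>M borel"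
    and m_median: "\<And>n. n \<ge> 1 \<Longrightarrow>
      AE \<omega> in \<Omega>. m n \<omega> \<in> frechet_medians (empirical_measure (\<lambda>k. X k \<omega>) n)"
    and unique: "frechet_medians \<mu> = {m0}"
  shows "AE \<omega> in \<Omega>. (\<lambda>n. m n \<omega>) \<longlonglongrightarrow> m0"
proof (rule AE_tendstoI)
  fix \<epsilon> :: real assume \<epsilon>: "\<epsilon> > 0"
  interpret prob_space \<Omega> by (rule prob)
  have \<mu>: "prob_space \<mu>" "sets \<mu> = sets borel" using mu by (auto simp: P1_def)
  obtain r where r: "measure \<mu> (cball m0 r) > 3/4"
    using exists_cball_measure_gt[OF \<mu>, of "3/4" m0] by auto
  have mass: "(\<integral>p. indicator (cball m0 r) p \<partial>\<mu>) = measure \<mu> (cball m0 r)"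
    using \<mu> sets_eq_imp_space_eq[OF \<mu>(2)] by simp
  have "AE \<omega> in \<Omega>. \<forall>n. n \<ge> 1 \<longrightarrow> m n \<omega> \<in> frechet_medians (empirical_measure (\<lambda>k. X k \<omega>) n)"
    unfolding AE_all_countable using m_median by auto
  moreover have "AE \<omega> in \<Omega>. (\<lambda>n. (\<Sum>k=1..n. indicator (cball m0 r) (X k \<omega>)) / real n)
      \<longlonglongrightarrow> (\<integral>p. indicator (cball m0 r) p \<partial>\<mu>)"
    by (rule bounded_strong_law_iid[OF X_indep X_law, where B = 1])
      (auto intro!: borel_measurable_indicator simp: indicator_le_1)
  moreover
  define K where "K = cball m0 (3 * r) - ball m0 \<epsilon>"
  have "compact K"
    unfolding K_def by (intro proper bounded_diff bounded_cball closed_Diff) auto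
  then have "AE \<omega> in \<Omega>. eventually (\<lambda>n. \<forall>y\<in>K.
      (\<Sum>k=1..n. dist y (X k \<omega>) - dist m0 (X k \<omega>)) / real n > 0) sequentially"
  proof (rule eventually_averages_pos_on_compact)
    fix x assume "x \<in> K"
    then have "x \<noteq> m0" using \<epsilon> by (auto simp: K_def)
    then show "(\<integral>p. dist x p - dist m0 p \<partial>\<mu>) > 0"
      by (rule unique_median_excess_pos[OF mu unique])
    show "AE \<omega> in \<Omega>. (\<lambda>n. (\<Sum>k=1..n. dist x (X k \<omega>) - dist m0 (X k \<omega>)) / real n)
        \<longlonglongrightarrow> (\<integral>p. dist x p - dist m0 p \<partial>\<mu>)"
      by (rule bounded_strong_law_iid[OF X_indep X_law])
        (auto intro!: borel_measurable_continuous_onI continuous_intros abs_dist_diff_le)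
  qed
  ultimately show "AE \<omega> in \<Omega>. eventually (\<lambda>n. dist (m n \<omega>) m0 < \<epsilon>) sequentially"
  proof eventually_elim
    case (elim \<omega>)
    note median = elim(1)
    have "eventually (\<lambda>n.
        (\<Sum>k=1..n. indicator (cball m0 r) (X k \<omega>)) / real n > (3/4::real)) sequentially"
      using elim(2) r mass by (intro order_tendstoD(1)) auto
    then show ?case using elim(3) eventually_ge_at_top[of 1]
    proof eventually_elim
      case (elim n)
      have med: "m n \<omega> \<in> frechet_medians (empirical_measure (\<lambda>k. X k \<omega>) n)"
        using median elim by blast
      have "dist (m n \<omega>) m0 \<le> 3 * r"
        using empirical_median_bounded[OF _ med] elim by auto
      moreover have "m n \<omega> \<notin> K"
        using empirical_median_average_nonpos[OF _ med, of m0] elim by force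
      ultimately show ?case by (auto simp: K_def dist_commute)
    qed
  qed
qed

end
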